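(* Let $r$ be a positive integer. If $G$ is a tree, then $\chi_{L,r}(G)=\min\{r,\Delta(G)\}+1$.
   Context: All graphs are finite and simple. $\Delta(G)$ is the maximum degree of $G$, $d_G(v)$ the degree of $v$, and $N_G(v)$ the set of neighbors of $v$. A list of $G$ is a map $L$ assigning to each vertex $v$ a set $L(v)\subseteq\mathbb{N}$ of colors; $L$ is a $k$-list if $|L(v)|=k$ for every $v\in V(G)$. For a positive integer $r$, an $(L,r)$-coloring of $G$ is a map $c:V(G)\to\mathbb{N}$ such that (1) $c(u)\neq c(v)$ for every edge $uv\in E(G)$; (2) $|c(N_G(v))|\geq\min\{d_G(v),r\}$ for every $v\in V(G)$; (3) $c(v)\in L(v)$ for every $v\in V(G)$. The list $r$-hued chromatic number $\chi_{L,r}(G)$ is the smallest integer $k$ such that for every $k$-list $L$ of $G$, $G$ has an $(L,r)$-coloring. *)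

theory Defs
  imports "Graph_Theory.Digraph_Component"
begin

text \<open>
  A finite simple graph is a \<open>graph\<close> in the sense of the library: a finite, loop-free, symmetric
  digraph without parallel arcs, so that each undirected edge \<open>uv\<close> is represented by the two arcs
  from \<open>u\<close> to \<open>v\<close> and from \<open>v\<close> to \<open>u\<close>.
\<close>

text \<open>
  The constant \<open>tree\<close> of the library does not describe undirected trees in this representation,
  since it counts the closed walk \<open>u, v, u\<close> along a single edge as a cycle. In a loop-free graph
  without parallel arcs the cycles of length at least 3 are exactly the cycles of the undirected
  graph. The library's \<open>connected\<close> excludes the null graph.
\<close>
definition undirected_tree :: "('a, 'b) pre_digraph \<Rightarrow> bool" where
  "undirected_tree G \<longleftrightarrow>
     graph G \<and> connected G \<and> \<not> (\<exists>p. pre_digraph.cycle G p \<and> 3 \<le> length p)"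

definition neighbors :: "('a, 'b) pre_digraph \<Rightarrow> 'a \<Rightarrow> 'a set" where
  "neighbors G v = {u. v \<rightarrow>\<^bsub>G\<^esub> u}"

text \<open>Each undirected edge at \<open>v\<close> contributes exactly one arc leaving \<open>v\<close>, so the degree of \<open>v\<close> is
  its out-degree.\<close>
definition degree :: "('a, 'b) pre_digraph \<Rightarrow> 'a \<Rightarrow> nat" where
  "degree G v = out_degree G v"

definition max_degree :: "('a, 'b) pre_digraph \<Rightarrow> nat" where
  "max_degree G = Max (degree G ` verts G)"

text \<open>Finiteness is required explicitly because \<open>card\<close> is 0 on infinite sets.\<close>
definition is_k_list :: "('a, 'b) pre_digraph \<Rightarrow> nat \<Rightarrow> ('a \<Rightarrow> nat set) \<Rightarrow> bool" where
  "is_k_list G k L \<longleftrightarrow> (\<forall>v \<in> verts G. finite (L v) \<and> card (L v) = k)"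

definition hued_list_coloring ::
    "('a, 'b) pre_digraph \<Rightarrow> ('a \<Rightarrow> nat set) \<Rightarrow> nat \<Rightarrow> ('a \<Rightarrow> nat) \<Rightarrow> bool" where
  "hued_list_coloring G L r c \<longleftrightarrow>
     (\<forall>u v. u \<rightarrow>\<^bsub>G\<^esub> v \<longrightarrow> c u \<noteq> c v) \<and>
     (\<forall>v \<in> verts G. card (c ` neighbors G v) \<ge> min (degree G v) r) \<and>
     (\<forall>v \<in> verts G. c v \<in> L v)"

definition list_hued_chromatic_number :: "nat \<Rightarrow> ('a, 'b) pre_digraph \<Rightarrow> nat" where
  "list_hued_chromatic_number r G =
     (LEAST k. \<forall>L. is_k_list G k L \<longrightarrow> (\<exists>c. hued_list_coloring G L r c))"

end

theory Submission
  imports Defs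
begin

text \<open>
  Lower bound: with identical lists of size \<open>k\<close>, a vertex of maximum degree and its neighbours
  already use \<open>min r \<Delta> + 1\<close> colours. Upper bound: colour greedily along an order in
  which every vertex \<open>v\<close> but the first has exactly one earlier neighbour \<open>p\<close>. It suffices that
  \<open>v\<close> avoids the colour of \<open>p\<close> and, as long as the coloured neighbours of \<open>p\<close> show fewer
  than \<open>r\<close> colours, these colours too; at most \<open>min r \<Delta>\<close> colours are thus forbidden.
\<close>

section \<open>Extending simple paths at their end\<close>

lemma (in wf_digraph) awalk_verts_snoc:
  assumes "cas u p (tail G e)"
  shows "awalk_verts u (p @ [e]) = awalk_verts u p @ [head G e]"
  using assms by (induct p arbitrary: u) auto

lemma (in wf_digraph) apath_snoc:
  assumes "apath u p (tail G e)" "e \<in> arcs G" "head G e \<notin> set (awalk_verts u p)"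
  shows "apath u (p @ [e]) (head G e)"
proof -
  have "awalk u p (tail G e)" using assms by (simp add: apath_def)
  moreover have "awalk (tail G e) [e] (head G e)"
    using assms(2) by (auto simp: awalk_Cons_iff awalk_Nil_iff)
  ultimately have "awalk u (p @ [e]) (head G e)" by (rule awalk_appendI)
  moreover have "awalk_verts u (p @ [e]) = awalk_verts u p @ [head G e]"
    using \<open>awalk u p (tail G e)\<close> by (intro awalk_verts_snoc) auto
  ultimately show ?thesis using assms by (simp add: apath_def)
qed

text \<open>Phrased with simple paths of \<open>G\<close> itself instead of an induced subgraph, so
  that such a path and a vertex outside \<open>S\<close> close up directly to a cycle of
  \<open>G\<close>.\<close>

definition path_connected_in :: "('a, 'b) pre_digraph \<Rightarrow> 'a set \<Rightarrow> bool" where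
  "path_connected_in G S \<longleftrightarrow>
     (\<forall>x \<in> S. \<forall>y \<in> S. \<exists>p. pre_digraph.apath G x p y \<and> set (pre_digraph.awalk_verts G x p) \<subseteq> S)"

section \<open>Neighbourhoods and degrees\<close>

lemma (in wf_digraph) dominatesE:
  assumes "u \<rightarrow>\<^bsub>G\<^esub> v"
  obtains e where "e \<in> arcs G" "tail G e = u" "head G e = v"
  using assms by (auto simp: arcs_ends_conv)

lemma (in graph) neighbors_sym: "u \<in> neighbors G v \<longleftrightarrow> v \<in> neighbors G u"
  using sym_arcs by (auto simp: neighbors_def symmetric_def dest: symD)

lemma (in graph) not_self_neighbor: "v \<notin> neighbors G v"
  using adj_not_same by (auto simp: neighbors_def)

lemma (in graph) neighbors_subset_verts: "neighbors G v \<subseteq> verts G"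
  by (auto simp: neighbors_def)

lemma (in graph) finite_neighbors: "finite (neighbors G v)"
  using neighbors_subset_verts finite_verts by (rule finite_subset)

lemma (in graph) card_neighbors: "card (neighbors G v) = degree G v"
proof -
  have "inj_on (head G) (out_arcs G v)"
    by (auto simp: inj_on_def arc_to_ends_def intro!: no_multi_arcs)
  moreover have "head G ` out_arcs G v = neighbors G v"
    by (auto simp: neighbors_def arcs_ends_conv image_iff)
  ultimately show ?thesis
    by (metis card_image degree_def out_degree_def)
qed

lemma (in graph) degree_le_max_degree:
  assumes "v \<in> verts G"
  shows "degree G v \<le> max_degree G"
  unfolding max_degree_def using assms finite_verts by (intro Max_ge) auto

section \<open>Building a tree vertex by vertex\<close>

lemma (in graph) path_connected_in_insert:
  assumes S: "path_connected_in G S" and p: "p \<in> S" and v: "v \<notin> S" "v \<in> neighbors G p"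
  shows "path_connected_in G (insert v S)"
  unfolding path_connected_in_def
proof (intro ballI)
  obtain e where e: "e \<in> arcs G" "tail G e = p" "head G e = v"
    using v(2) by (auto simp: neighbors_def elim: dominatesE)
  obtain f where f: "f \<in> arcs G" "tail G f = v" "head G f = p"
    using v(2) unfolding neighbors_sym[of v] by (auto simp: neighbors_def elim: dominatesE)
  fix x y assume "x \<in> insert v S" "y \<in> insert v S"
  then consider "x = v" "y = v" | "x \<in> S" "y \<in> S" | "x \<in> S" "y = v" | "x = v" "y \<in> S" by blast
  then show "\<exists>q. apath x q y \<and> set (awalk_verts x q) \<subseteq> insert v S"
  proof cases
    case 1
    have "apath v [] v" using e wellformed by (auto simp: apath_Nil_iff)
    with 1 show ?thesis by (intro exI[of _ "[]"]) auto
  next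
    case 2
    then show ?thesis using S unfolding path_connected_in_def by blast
  next
    case 3
    then obtain q where q: "apath x q p" "set (awalk_verts x q) \<subseteq> S"
      using S p unfolding path_connected_in_def by blast
    then have "apath x (q @ [e]) v"
      using apath_snoc[of x q e] e v by blast
    moreover have "awalk_verts x (q @ [e]) = awalk_verts x q @ [v]"
      using q e awalk_verts_snoc[of x q e] by (auto simp: apath_def)
    ultimately show ?thesis using 3 q by (intro exI[of _ "q @ [e]"]) auto
  next
    case 4
    then obtain q where q: "apath p q y" "set (awalk_verts p q) \<subseteq> S"
      using S p unfolding path_connected_in_def by blast
    with v f have "apath v (f # q) y" by (auto simp: apath_Cons_iff)
    then show ?thesis using 4 q f by (intro exI[of _ "f # q"]) auto
  qed
qed

text \<open>A path inside \<open>S\<close> from \<open>p\<close> to \<open>q\<close> is closed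
  through \<open>v\<close>, which it avoids. In a tree, \<open>v\<close> can therefore have at most
  one neighbour in \<open>S\<close>.\<close>

lemma (in graph) two_neighbors_imp_cycle:
  assumes S: "path_connected_in G S" and v: "v \<notin> S"
    and pq: "p \<in> neighbors G v \<inter> S" "q \<in> neighbors G v \<inter> S" "p \<noteq> q"
  shows "\<exists>w. cycle w \<and> 3 \<le> length w"
proof -
  obtain w where w: "apath p w q" "set (awalk_verts p w) \<subseteq> S"
    using S pq unfolding path_connected_in_def by blast
  obtain f where f: "f \<in> arcs G" "tail G f = v" "head G f = p"
    using pq by (auto simp: neighbors_def elim: dominatesE)
  obtain e where e: "e \<in> arcs G" "tail G e = q" "head G e = v"
    using pq neighbors_sym[of q v] by (auto simp: neighbors_def elim: dominatesE)
  have "w \<noteq> []" using w pq(3) by (auto simp: apath_Nil_iff)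
  have a: "apath p (w @ [e]) v" using apath_snoc[of p w e] w e v by blast
  then have "awalk v (f # w @ [e]) v" using f by (simp add: apath_def awalk_Cons_iff del: awalk_append_iff)
  \<comment> \<open>The tail drops the first of the two occurrences of \<open>v\<close> and leaves
    the vertices of a simple path.\<close>
  moreover have "distinct (tl (awalk_verts v (f # w @ [e])))"
    using a f by (simp add: apath_def)
  ultimately have "cycle (f # w @ [e])" unfolding cycle_def by blast
  \<comment> \<open>As \<open>p\<close> and \<open>q\<close> differ, \<open>w\<close> has an arc;
    this rules out the closed walk of length 2 along a single edge.\<close>
  moreover have "3 \<le> length (f # w @ [e])" using \<open>w \<noteq> []\<close> by (cases w) auto
  ultimately show ?thesis by blast
qed

lemma (in graph) connected_imp_edge_leaving:
  assumes "connected G" "S \<subseteq> verts G" "S \<noteq> {}" "S \<noteq> verts G"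
  obtains p v where "p \<in> S" "v \<in> verts G - S" "p \<in> neighbors G v"
proof -
  obtain x y where xy: "x \<in> S" "y \<in> verts G - S" using assms by blast
  have "x \<rightarrow>\<^sup>*\<^bsub>mk_symmetric G\<^esub> y"
    using assms(1) xy assms(2) by (auto simp: connected_def strongly_connected_def)
  \<comment> \<open>\<open>connected\<close> refers to the symmetric closure, which has the same
    reachability as the symmetric graph \<open>G\<close>.\<close>
  then have "x \<rightarrow>\<^sup>*\<^bsub>G\<^esub> y"
    using reachable_mk_symmetric_eq by blast
  then have "\<exists>p v. p \<in> S \<and> v \<in> verts G - S \<and> p \<rightarrow>\<^bsub>G\<^esub> v"
    using xy
  proof (induct rule: reachable_induct)
    case (step z y)
    then show ?case by (cases "z \<in> S") auto
  qed blast
  then show thesis using that neighbors_sym by (auto simp: neighbors_def)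
qed

text \<open>Connectedness supplies an edge from the set built so far to a new vertex; acyclicity
  makes it the only one. So each stage attaches a leaf.\<close>

lemma undirected_tree_induct [consumes 2, case_names root leaf]:
  assumes tree: "undirected_tree G" and a: "a \<in> verts G"
    and root: "P {a}"
    and leaf: "\<And>S p v. S \<subseteq> verts G \<Longrightarrow> p \<in> S \<Longrightarrow> v \<in> verts G - S \<Longrightarrow>
                 neighbors G v \<inter> S = {p} \<Longrightarrow> P S \<Longrightarrow> P (insert v S)"
  shows "P (verts G)"
proof -
  interpret graph G using tree by (simp add: undirected_tree_def)
  \<comment> \<open>The induction on the size of \<open>S\<close> carries path-connectedness for the
    cycle argument and nonemptiness for the edge that leaves \<open>S\<close>.\<close>
  have "\<exists>S \<subseteq> verts G. card S = n \<and> S \<noteq> {} \<and> path_connected_in G S \<and> P S"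
    if "1 \<le> n" "n \<le> card (verts G)" for n
    using that
  proof (induct n rule: dec_induct)
    case base
    have "apath a [] a" using a by (simp add: apath_Nil_iff)
    then have "path_connected_in G {a}"
      by (auto simp: path_connected_in_def intro!: exI[of _ "[]"])
    then show ?case using a root by (intro exI[of _ "{a}"]) auto
  next
    case (step n)
    then obtain S where S: "S \<subseteq> verts G" "card S = n" "S \<noteq> {}" "path_connected_in G S" "P S"
      by auto
    then have "S \<noteq> verts G" using step by auto
    then obtain p v where pv: "p \<in> S" "v \<in> verts G - S" "p \<in> neighbors G v"
      using connected_imp_edge_leaving tree S by (metis undirected_tree_def)
    have "neighbors G v \<inter> S = {p}"
      using two_neighbors_imp_cycle[OF S(4), of v p] pv tree
      by (auto simp: undirected_tree_def)
    then have "P (insert v S)" using leaf S pv by blast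
    moreover have "path_connected_in G (insert v S)"
      using path_connected_in_insert S pv neighbors_sym by blast
    moreover have "card (insert v S) = Suc n"
      using S pv finite_subset[OF S(1) finite_verts] by simp
    ultimately show ?case using S pv by (intro exI[of _ "insert v S"]) auto
  qed
  moreover have "1 \<le> card (verts G)"
    using a finite_verts by (metis One_nat_def Suc_leI card_gt_0_iff empty_iff)
  ultimately obtain S where "S \<subseteq> verts G" "card S = card (verts G)" "P S" by blast
  then show ?thesis using finite_verts by (metis card_subset_eq)
qed

text \<open>The invariant of the greedy colouring: a hued list colouring of the subgraph induced on
  \<open>S\<close>. Degrees are counted inside \<open>S\<close>, so neighbours still uncoloured
  create no demand.\<close>

definition partial_hued_coloring ::
    "('a, 'b) pre_digraph \<Rightarrow> ('a \<Rightarrow> nat set) \<Rightarrow> nat \<Rightarrow> 'a set \<Rightarrow> ('a \<Rightarrow> nat) \<Rightarrow> bool" where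
  "partial_hued_coloring G L r S c \<longleftrightarrow>
     (\<forall>u \<in> S. \<forall>v \<in> neighbors G u \<inter> S. c u \<noteq> c v) \<and>
     (\<forall>v \<in> S. min (card (neighbors G v \<inter> S)) r \<le> card (c ` (neighbors G v \<inter> S))) \<and>
     (\<forall>v \<in> S. c v \<in> L v)"

text \<open>Among the vertices of \<open>S\<close>, only \<open>p\<close> gains a coloured
  neighbour, and \<open>v\<close> sees only \<open>p\<close>. Hence the new colour has to be right
  for \<open>p\<close> alone.\<close>

lemma (in graph) partial_hued_coloring_insert:
  assumes r: "r \<ge> 1" and p: "p \<in> verts G"
    and L: "finite (L v)" "card (L v) = min r (max_degree G) + 1"
    and v: "v \<notin> S" "neighbors G v \<inter> S = {p}"
    and c: "partial_hued_coloring G L r S c"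
  shows "\<exists>c'. partial_hued_coloring G L r (insert v S) c'"
proof -
  let ?C = "c ` (neighbors G p \<inter> S)"
  have vp: "v \<in> neighbors G p" using v neighbors_sym by blast
  have fin: "finite (neighbors G u \<inter> S)" for u using finite_neighbors by simp
  \<comment> \<open>The inequality is strict because \<open>v\<close> is a neighbour of
    \<open>p\<close> outside \<open>S\<close>; this leaves room to forbid \<open>c p\<close> as
    well.\<close>
  have "card (neighbors G p \<inter> S) < card (neighbors G p)"
    using vp v(1) finite_neighbors by (intro psubset_card_mono) auto
  then have d: "card (neighbors G p \<inter> S) < max_degree G"
    using degree_le_max_degree[OF p] by (simp add: card_neighbors)
  have C: "card ?C \<le> card (neighbors G p \<inter> S)" by (rule card_image_le[OF fin])
  define F where "F = insert (c p) (if card ?C < r then ?C else {})"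
  have "card F \<le> Suc (card (if card ?C < r then ?C else {}))"
    unfolding F_def by (rule card_insert_le_m1) auto
  \<comment> \<open>If \<open>?C\<close> has fewer than \<open>r\<close> colours, its size is below
    both \<open>r\<close> and the maximum degree. Otherwise \<open>F\<close> is a singleton and the
    list has at least two colours.\<close>
  then have "card F < card (L v)" using r d C by (auto simp: L split: if_splits)
  moreover have "finite F" using fin by (simp add: F_def)
  ultimately obtain x where x: "x \<in> L v" "x \<notin> F"
    by (meson card_mono linorder_not_less subsetI)
  let ?c = "c(v := x)"
  have same: "?c ` (neighbors G u \<inter> S) = c ` (neighbors G u \<inter> S)" for u
    using v(1) by (intro image_cong) auto
  have "min (card (neighbors G u \<inter> insert v S)) r \<le> card (?c ` (neighbors G u \<inter> insert v S))"
    if u: "u \<in> insert v S" for u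
  proof -
    consider "u = v" | "u = p" "u \<noteq> v" | "u \<in> S" "u \<noteq> p" using u v by blast
    then show ?thesis
    proof cases
      case 1
      then have "neighbors G u \<inter> insert v S = {p}" using v not_self_neighbor by blast
      then show ?thesis by (simp del: fun_upd_apply)
    next
      case 2
      have eq: "neighbors G p \<inter> insert v S = insert v (neighbors G p \<inter> S)" using vp by blast
      have N: "card (neighbors G p \<inter> insert v S) = Suc (card (neighbors G p \<inter> S))"
        unfolding eq using v(1) fin by simp
      have img: "?c ` (neighbors G p \<inter> insert v S) = insert x ?C"
        unfolding eq image_insert same by simp
      have old: "min (card (neighbors G p \<inter> S)) r \<le> card ?C"
        using c v by (auto simp: partial_hued_coloring_def)
      show ?thesis
      \<comment> \<open>Either \<open>x\<close> is a new colour at \<open>p\<close> and both sides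
        grow by at most and exactly one, or \<open>p\<close> already sees \<open>r\<close>
        colours.\<close>
      proof (cases "card ?C < r")
        case True
        then have "x \<notin> ?C" using x by (simp add: F_def)
        then have "card (insert x ?C) = Suc (card ?C)" using fin by simp
        then show ?thesis using old N img 2 by simp
      next
        case False
        moreover have "card ?C \<le> card (insert x ?C)" using fin by (intro card_mono) auto
        ultimately show ?thesis using N img 2 by simp
      qed
    next
      case 3
      then have "v \<notin> neighbors G u" using v neighbors_sym by blast
      then have "neighbors G u \<inter> insert v S = neighbors G u \<inter> S" by blast
      then show ?thesis using c 3 same by (simp add: partial_hued_coloring_def)
    qed
  qed
  moreover have "?c u \<noteq> ?c w" if "u \<in> insert v S" "w \<in> neighbors G u \<inter> insert v S" for u w
  proof -
    have "w \<noteq> u" using that not_self_neighbor by blast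
    have "x \<noteq> c p" using x by (simp add: F_def)
    then show ?thesis
      using that \<open>w \<noteq> u\<close> v c neighbors_sym[of w u]
      by (auto simp: partial_hued_coloring_def)
  qed
  moreover have "\<forall>u \<in> insert v S. ?c u \<in> L u"
    using c x by (auto simp: partial_hued_coloring_def)
  ultimately have "partial_hued_coloring G L r (insert v S) ?c"
    unfolding partial_hued_coloring_def by blast
  then show ?thesis by blast
qed

lemma undirected_tree_hued_list_colorable:
  assumes r: "r \<ge> 1" and tree: "undirected_tree G"
    and L: "is_k_list G (min r (max_degree G) + 1) L"
  shows "\<exists>c. hued_list_coloring G L r c"
proof -
  interpret graph G using tree by (simp add: undirected_tree_def)
  obtain a where a: "a \<in> verts G"
    using tree by (auto simp: undirected_tree_def connected_def strongly_connected_def)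
  from tree a have "\<exists>c. partial_hued_coloring G L r (verts G) c"
  proof (induct rule: undirected_tree_induct)
    case root
    have "L a \<noteq> {}" using L a by (auto simp: is_k_list_def)
    then obtain x where "x \<in> L a" by blast
    moreover have "neighbors G a \<inter> {a} = {}" using not_self_neighbor by blast
    ultimately have "partial_hued_coloring G L r {a} (\<lambda>_. x)"
      by (auto simp: partial_hued_coloring_def)
    then show ?case by blast
  next
    case (leaf S p v)
    then show ?case using L r partial_hued_coloring_insert[of r p L v S]
      by (auto simp: is_k_list_def)
  qed
  then obtain c where c: "partial_hued_coloring G L r (verts G) c" by blast
  \<comment> \<open>On the whole vertex set the degrees inside \<open>S\<close> become the true
    degrees, so the invariant is the required colouring.\<close>
  have "neighbors G v \<inter> verts G = neighbors G v" for v using neighbors_subset_verts by blast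
  then have "hued_list_coloring G L r c"
    using c adj_in_verts(1)
    by (simp add: hued_list_coloring_def partial_hued_coloring_def card_neighbors)
      (auto simp: neighbors_def)
  then show ?thesis by blast
qed

section \<open>Lower bound from constant lists\<close>

lemma (in graph) hued_list_colorable_lower_bound:
  assumes "verts G \<noteq> {}" and col: "\<And>L. is_k_list G k L \<Longrightarrow> \<exists>c. hued_list_coloring G L r c"
  shows "min r (max_degree G) + 1 \<le> k"
proof -
  have "is_k_list G k (\<lambda>_. {..<k})" by (simp add: is_k_list_def)
  then obtain c where c: "hued_list_coloring G (\<lambda>_. {..<k}) r c" using col by blast
  have "max_degree G \<in> degree G ` verts G"
    unfolding max_degree_def using assms(1) finite_verts by (intro Max_in) auto
  then obtain v where v: "v \<in> verts G" "degree G v = max_degree G" by auto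
  let ?C = "c ` neighbors G v"
  have "insert (c v) ?C \<subseteq> {..<k}"
    using c v(1) neighbors_subset_verts[of v] by (auto simp: hued_list_coloring_def)
  then have "card (insert (c v) ?C) \<le> k" by (metis card_lessThan card_mono finite_lessThan)
  \<comment> \<open>The colour of \<open>v\<close> itself accounts for the additional 1.\<close>
  moreover have "c v \<notin> ?C" using c by (auto simp: hued_list_coloring_def neighbors_def)
  moreover have "min (max_degree G) r \<le> card ?C"
    using c v by (auto simp: hued_list_coloring_def)
  ultimately show ?thesis using finite_neighbors by simp
qed

theorem theorem1p5:
  fixes G :: "('a, 'b) pre_digraph" and r :: nat
  assumes "r \<ge> 1" and "undirected_tree G"
  shows "list_hued_chromatic_number r G = min r (max_degree G) + 1"
  unfolding list_hued_chromatic_number_def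
proof (rule Least_equality)
  show "\<forall>L. is_k_list G (min r (max_degree G) + 1) L \<longrightarrow> (\<exists>c. hued_list_coloring G L r c)"
    using undirected_tree_hued_list_colorable assms by blast
next
  fix k assume "\<forall>L. is_k_list G k L \<longrightarrow> (\<exists>c. hued_list_coloring G L r c)"
  \<comment> \<open>\<open>connected\<close> excludes the null graph, so a vertex of maximum degree
    exists.\<close>
  moreover have "graph G" "verts G \<noteq> {}"
    using assms(2) by (auto simp: undirected_tree_def connected_def strongly_connected_def)
  ultimately show "min r (max_degree G) + 1 \<le> k"
    using graph.hued_list_colorable_lower_bound by blast
qed

end
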